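(* Let $G$ be a class 2 graph with maximum degree $\Delta$, and let $r\in V(G)$ be a light $\Delta$-vertex. For any $s\in N(r)$ with $d(s)<\Delta$, if $rs$ is a critical edge of $G$, then all vertices in $N(s)\setminus N(r)$ are $\Delta$-vertices.
   Context: All graphs are finite and simple. $\chi'(G)$ is the chromatic index; $G$ is class 2 if $\chi'(G)=\Delta(G)+1$, where $\Delta(G)$ is the maximum degree. $N(v)$ is the set of neighbors of $v$ in $G$ and $d(v)=|N(v)|$. A $k$-vertex is a vertex of degree $k$ in $G$. A vertex is light if it is adjacent to at most two $\Delta(G)$-vertices. An edge $e$ of $G$ is critical if $\chi'(G-e)<\chi'(G)$. *)

theory Defs
  imports Main
begin

record 'a graph =
  verts :: "'a set"
  edges :: "'a set set"

text \<open>Finite simple graphs: an edge is the set of its two (distinct) end vertices.\<close>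

definition simple_graph :: "'a graph \<Rightarrow> bool" where
  "simple_graph G \<longleftrightarrow> finite (verts G) \<and> (\<forall>e\<in>edges G. e \<subseteq> verts G \<and> card e = 2)"

definition neighbors :: "'a graph \<Rightarrow> 'a \<Rightarrow> 'a set" where
  "neighbors G v = {w. {v, w} \<in> edges G}"

definition degree :: "'a graph \<Rightarrow> 'a \<Rightarrow> nat" where
  "degree G v = card (neighbors G v)"

text \<open>Unspecified for the graph without vertices.\<close>

definition max_degree :: "'a graph \<Rightarrow> nat" where
  "max_degree G = Max (degree G ` verts G)"

definition proper_edge_coloring :: "'a graph \<Rightarrow> nat \<Rightarrow> ('a set \<Rightarrow> nat) \<Rightarrow> bool" where
  "proper_edge_coloring G k c \<longleftrightarrow>
     c ` edges G \<subseteq> {..<k} \<and>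
     (\<forall>e\<in>edges G. \<forall>f\<in>edges G. e \<noteq> f \<and> e \<inter> f \<noteq> {} \<longrightarrow> c e \<noteq> c f)"

definition chromatic_index :: "'a graph \<Rightarrow> nat" where
  "chromatic_index G = (LEAST k. \<exists>c. proper_edge_coloring G k c)"

definition class2 :: "'a graph \<Rightarrow> bool" where
  "class2 G \<longleftrightarrow> chromatic_index G = max_degree G + 1"

definition k_vertex :: "'a graph \<Rightarrow> nat \<Rightarrow> 'a \<Rightarrow> bool" where
  "k_vertex G k v \<longleftrightarrow> v \<in> verts G \<and> degree G v = k"

definition light :: "'a graph \<Rightarrow> 'a \<Rightarrow> bool" where
  "light G v \<longleftrightarrow> v \<in> verts G \<and> card {w \<in> neighbors G v. k_vertex G (max_degree G) w} \<le> 2"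

definition delete_edge :: "'a graph \<Rightarrow> 'a set \<Rightarrow> 'a graph" where
  "delete_edge G e = G\<lparr>edges := edges G - {e}\<rparr>"

definition critical_edge :: "'a graph \<Rightarrow> 'a set \<Rightarrow> bool" where
  "critical_edge G e \<longleftrightarrow>
     e \<in> edges G \<and> chromatic_index (delete_edge G e) < chromatic_index G"

lemma simple_graph_delete_edge: "simple_graph G \<Longrightarrow> simple_graph (delete_edge G e)"
  by (auto simp: simple_graph_def delete_edge_def)

lemma finite_edges:
  assumes "simple_graph G"
  shows "finite (edges G)"
proof (rule finite_subset)
  show "edges G \<subseteq> Pow (verts G)" using assms by (auto simp: simple_graph_def)
  show "finite (Pow (verts G))" using assms by (simp add: simple_graph_def)
qed

text \<open>For a finite simple graph the minimum defining the chromatic index is attained.\<close>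

lemma chromatic_index_attained:
  assumes "simple_graph G"
  shows "\<exists>c. proper_edge_coloring G (chromatic_index G) c"
proof -
  obtain c where "bij_betw c (edges G) {0..<card (edges G)}"
    using ex_bij_betw_finite_nat[OF finite_edges[OF assms]] by blast
  then have "proper_edge_coloring G (card (edges G)) c"
    by (auto simp: proper_edge_coloring_def bij_betw_def inj_on_def)
  then show ?thesis
    unfolding chromatic_index_def by (intro LeastI) blast
qed

end

theory Submission
  imports Defs
begin

text \<open>
  Let \<open>c\<close> be a \<open>\<Delta>\<close>-edge-colouring of \<open>G - rs\<close>. By Vizing's argument the missing colours of the
  vertices in a fan at \<open>r\<close> started by \<open>s\<close> are pairwise disjoint, so, by counting, the subfan started
  by any single colour missing at \<open>s\<close> contains a neighbour of \<open>r\<close> missing no colour, i.e. a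
  \<open>\<Delta>\<close>-vertex, and subfans of distinct missing colours are disjoint. As \<open>s\<close> misses at least two colours
  and \<open>r\<close> has at most two \<open>\<Delta>\<close>-neighbours, a third disjoint subfan of this kind is impossible.
  Suppose \<open>v \<in> N(s) - N(r)\<close> misses a colour. If \<open>G - rs + rv\<close> is not \<open>\<Delta>\<close>-edge-colourable, then
  \<open>v\<close> also starts a fan at \<open>r\<close>, which gives the third subfan. Otherwise some colouring of \<open>G - rs\<close> has
  a colour missing at both \<open>r\<close> and \<open>v\<close>, and Kempe changes at \<open>v\<close> show that the subfan started by
  the colour of \<open>sv\<close> is the third one.
\<close>

section \<open>Edge colourings, missing colours and fans over a set of edges\<close>

definition edge_colouring :: "'a set set \<Rightarrow> nat \<Rightarrow> ('a set \<Rightarrow> nat) \<Rightarrow> bool" where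
  "edge_colouring E k c \<longleftrightarrow>
     c ` E \<subseteq> {..<k} \<and> (\<forall>e\<in>E. \<forall>f\<in>E. e \<noteq> f \<and> e \<inter> f \<noteq> {} \<longrightarrow> c e \<noteq> c f)"

definition missing :: "'a set set \<Rightarrow> nat \<Rightarrow> ('a set \<Rightarrow> nat) \<Rightarrow> 'a \<Rightarrow> nat set" where
  "missing E k c x = {\<alpha>. \<alpha> < k \<and> (\<forall>e\<in>E. x \<in> e \<longrightarrow> c e \<noteq> \<alpha>)}"

text \<open>The vertices of a Vizing fan with centre \<open>r\<close>, taken as a set closed under
  all continuations instead of one sequence. The initial colours \<open>A\<close> are a parameter,
  so that the fan can be split by its first colour and also be started by a colour not missing at
  \<open>s\<close>.\<close>

inductive_set fan :: "'a set set \<Rightarrow> nat \<Rightarrow> ('a set \<Rightarrow> nat) \<Rightarrow> 'a \<Rightarrow> nat set \<Rightarrow> 'a set"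
  for E k c r A where
  start: "{r, y} \<in> E \<Longrightarrow> c {r, y} \<in> A \<Longrightarrow> y \<in> fan E k c r A"
| step: "x \<in> fan E k c r A \<Longrightarrow> {r, y} \<in> E \<Longrightarrow> c {r, y} \<in> missing E k c x \<Longrightarrow> y \<in> fan E k c r A"

lemma edge_colouring_same_colour:
  assumes "edge_colouring E k c" "{x, y} \<in> E" "{x, z} \<in> E" "c {x, y} = c {x, z}"
  shows "y = z"
proof (rule ccontr)
  assume "y \<noteq> z"
  then have "{x, y} \<noteq> {x, z}" by (auto simp: doubleton_eq_iff)
  moreover have "{x, y} \<inter> {x, z} \<noteq> {}" by auto
  ultimately show False using assms unfolding edge_colouring_def by metis
qed

lemma edge_colouring_insert:
  assumes col: "edge_colouring E k c" and "e \<notin> E" "\<eta> < k"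
    and ne: "\<And>f. f \<in> E \<Longrightarrow> e \<inter> f \<noteq> {} \<Longrightarrow> c f \<noteq> \<eta>"
  shows "edge_colouring (insert e E) k (c(e := \<eta>))"
  unfolding edge_colouring_def
proof (intro conjI ballI impI)
  show "(c(e := \<eta>)) ` insert e E \<subseteq> {..<k}"
    using assms by (auto simp: edge_colouring_def)
  fix f g assume fg: "f \<in> insert e E" "g \<in> insert e E" "f \<noteq> g \<and> f \<inter> g \<noteq> {}"
  then consider "f = e" "g \<in> E" "g \<noteq> e" | "g = e" "f \<in> E" "f \<noteq> e"
    | "f \<noteq> e" "g \<noteq> e" "f \<in> E" "g \<in> E" by blast
  then show "(c(e := \<eta>)) f \<noteq> (c(e := \<eta>)) g"
  proof cases
    case 1 then show ?thesis using ne[of g] fg by auto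
  next
    case 2 then show ?thesis using ne[of f] fg by auto
  next
    case 3 then show ?thesis using col fg by (auto simp: edge_colouring_def)
  qed
qed

lemma edge_colouring_mono: "edge_colouring E k c \<Longrightarrow> F \<subseteq> E \<Longrightarrow> edge_colouring F k c"
  unfolding edge_colouring_def by blast

lemma fan_edge: "y \<in> fan E k c r A \<Longrightarrow> {r, y} \<in> E"
  by (induction rule: fan.induct) auto

lemma fan_mono: "A \<subseteq> B \<Longrightarrow> fan E k c r A \<subseteq> fan E k c r B"
proof
  fix y assume "A \<subseteq> B" "y \<in> fan E k c r A"
  from this(2,1) show "y \<in> fan E k c r B"
    by (induction rule: fan.induct) (auto intro: fan.intros)
qed

lemma fan_singleton:
  assumes "y \<in> fan E k c r A"
  shows "\<exists>\<alpha>\<in>A. y \<in> fan E k c r {\<alpha>}"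
  using assms by (induction rule: fan.induct) (auto intro: fan.intros)

text \<open>Agreement on the fan of \<open>c\<close> suffices, since by induction neither fan ever
  steps outside it.\<close>

lemma fan_cong:
  assumes r: "\<And>y. {r, y} \<in> E \<Longrightarrow> c' {r, y} = c {r, y}"
    and m: "\<And>x. x \<in> fan E k c r A \<Longrightarrow> missing E k c' x = missing E k c x"
  shows "fan E k c' r A = fan E k c r A"
proof (intro set_eqI iffI)
  fix y assume "y \<in> fan E k c' r A"
  then show "y \<in> fan E k c r A"
  proof (induction rule: fan.induct)
    case (start y) then show ?case using r by (auto intro: fan.start)
  next
    case (step x y) then show ?case using r m by (metis fan.step)
  qed
next
  fix y assume "y \<in> fan E k c r A"
  then show "y \<in> fan E k c' r A"
  proof (induction rule: fan.induct)
    case (start y) then show ?case using r by (auto intro: fan.start)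
  next
    case (step x y) then show ?case using r m by (metis fan.step)
  qed
qed

text \<open>The colour of \<open>{r, y}\<close> tells how \<open>y\<close> entered a fan: through
  the initial colour, or from the only fan vertex missing that colour. So a common vertex passes the
  property back to a common predecessor, and down at the start \<open>ne\<close>, \<open>a\<close>
  and \<open>b\<close> exclude it.\<close>

lemma fan_disjoint:
  assumes ne: "\<alpha> \<noteq> \<beta>"
    and a: "\<And>y. y \<in> fan E k c r {\<beta>} \<Longrightarrow> \<alpha> \<notin> missing E k c y"
    and b: "\<And>x. x \<in> fan E k c r {\<alpha>} \<Longrightarrow> \<beta> \<notin> missing E k c x"
    and d: "\<And>x y. x \<in> fan E k c r {\<alpha>} \<Longrightarrow> y \<in> fan E k c r {\<beta>} \<Longrightarrow> x \<noteq> y \<Longrightarrow>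
              missing E k c x \<inter> missing E k c y = {}"
  shows "fan E k c r {\<alpha>} \<inter> fan E k c r {\<beta>} = {}"
proof -
  have "y \<notin> fan E k c r {\<beta>}" if "y \<in> fan E k c r {\<alpha>}" for y
    using that
  proof (induction rule: fan.induct)
    case (start y)
    show ?case
    proof
      assume "y \<in> fan E k c r {\<beta>}"
      then show False by cases (use start ne a in auto)
    qed
  next
    case (step x y)
    show ?case
    proof
      assume "y \<in> fan E k c r {\<beta>}"
      then show False
      proof cases
        case start then show False using step b by auto
      next
        case (step x')
        with \<open>x \<in> fan E k c r {\<alpha>}\<close> \<open>c {r, y} \<in> missing E k c x\<close> d[of x x']
          \<open>x \<notin> fan E k c r {\<beta>}\<close>
        show False by blast
      qed
    qed
  qed
  then show ?thesis by blast
qed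

section \<open>Fan paths and the shifting of colours along them\<close>

fun fan_path :: "'a set set \<Rightarrow> nat \<Rightarrow> ('a set \<Rightarrow> nat) \<Rightarrow> 'a \<Rightarrow> 'a \<Rightarrow> 'a list \<Rightarrow> bool" where
  "fan_path E k c r x [] \<longleftrightarrow> True"
| "fan_path E k c r x (y # ys) \<longleftrightarrow>
     {r, y} \<in> E \<and> c {r, y} \<in> missing E k c x \<and> fan_path E k c r y ys"

lemma fan_path_append:
  "fan_path E k c r x (ys @ zs) \<longleftrightarrow>
     fan_path E k c r x ys \<and> fan_path E k c r (last (x # ys)) zs"
  by (induction ys arbitrary: x) auto

lemma fan_path_mono:
  assumes "fan_path E k c r x ys"
    and "\<And>y. y \<in> set ys \<Longrightarrow> {r, y} \<in> E \<Longrightarrow> {r, y} \<in> E' \<and> c' {r, y} = c {r, y}"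
    and "\<And>y. y \<in> set (x # ys) \<Longrightarrow> missing E k c y \<subseteq> missing E' k c' y"
  shows "fan_path E' k c' r x ys"
  using assms by (induction ys arbitrary: x) auto

text \<open>The path grows one vertex at a time; if the new vertex already lies on it, the path is
  cut there, which keeps the vertices distinct.\<close>

lemma fan_path_exists:
  assumes "y \<in> fan E k c r (missing E k c s)" "{r, s} \<notin> E"
  shows "\<exists>ys. fan_path E k c r s ys \<and> distinct (s # ys) \<and> last (s # ys) = y"
  using assms
proof (induction rule: fan.induct)
  case (start y)
  then show ?case by (intro exI[of _ "[y]"]) auto
next
  case (step x y)
  then obtain ys where ys: "fan_path E k c r s ys" "distinct (s # ys)" "last (s # ys) = x" by blast
  show ?case
  proof (cases "y \<in> set ys")
    case True
    then obtain as bs where "ys = as @ y # bs" by (meson split_list)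
    with ys show ?thesis by (intro exI[of _ "as @ [y]"]) (auto simp: fan_path_append)
  next
    case False
    moreover have "y \<noteq> s" using step by auto
    ultimately show ?thesis using ys step
      by (intro exI[of _ "ys @ [y]"]) (auto simp: fan_path_append)
  qed
qed

text \<open>Shifting the colours along the path moves the uncoloured edge to its last vertex.\<close>

lemma colourable_if_fan_path:
  assumes "edge_colouring E k c" "{r, s} \<notin> E" "r \<noteq> s" "\<forall>e\<in>E. card e = 2"
    and "fan_path E k c r s ys" "distinct (s # ys)"
    and "\<mu> \<in> missing E k c r" "\<mu> \<in> missing E k c (last (s # ys))"
  shows "\<exists>c'. edge_colouring (insert {r, s} E) k c'"
  using assms
proof (induction ys arbitrary: E c s)
  case Nil
  have "edge_colouring (insert {r, s} E) k (c({r, s} := \<mu>))"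
  proof (rule edge_colouring_insert)
    fix f assume f: "f \<in> E" "{r, s} \<inter> f \<noteq> {}"
    then have "r \<in> f \<or> s \<in> f" by auto
    with f(1) Nil.prems(7,8) show "c f \<noteq> \<mu>" by (auto simp: missing_def)
  qed (use Nil.prems in \<open>auto simp: missing_def\<close>)
  then show ?case by blast
next
  case (Cons y ys)
  define \<eta> where "\<eta> = c {r, y}"
  \<comment> \<open>The colour of \<open>{r, y}\<close> moves to \<open>{r, s}\<close>. Now
    \<open>{r, y}\<close> is the uncoloured edge, and the induction hypothesis applies with
    \<open>y\<close> in the role of \<open>s\<close>.\<close>
  define E' where "E' = insert {r, s} (E - {{r, y}})"
  define c' where "c' = c({r, s} := \<eta>)"
  have ry: "{r, y} \<in> E" and \<eta>s: "\<eta> \<in> missing E k c s" and path: "fan_path E k c r y ys"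
    using Cons.prems by (auto simp: \<eta>_def)
  have ney: "r \<noteq> y" using bspec[OF Cons.prems(4) ry] by auto
  have ysr: "r \<notin> set ys"
  proof
    assume "r \<in> set ys"
    then obtain as bs where "ys = as @ r # bs" by (meson split_list)
    then have "{r, r} \<in> E" using path by (auto simp: fan_path_append)
    then show False using bspec[OF Cons.prems(4)] by fastforce
  qed
  have dist: "s \<noteq> y" "s \<notin> set ys" "y \<notin> set ys" "distinct ys" using Cons.prems by auto
  have uniq: "c e \<noteq> \<eta>" if "e \<in> E" "e \<noteq> {r, y}" "r \<in> e" for e
  proof -
    have "e \<inter> {r, y} \<noteq> {}" using that(3) by auto
    with that ry Cons.prems(1) show ?thesis unfolding edge_colouring_def \<eta>_def by metis
  qed
  have uniqs: "c e \<noteq> \<eta>" if "e \<in> E" "s \<in> e" for e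
    using that \<eta>s unfolding missing_def by blast
  have \<eta>k: "\<eta> < k" using \<eta>s unfolding missing_def by blast
  have ins: "insert {r, y} E' = insert {r, s} E" using ry by (auto simp: E'_def)
  have col: "edge_colouring E' k c'"
    unfolding E'_def c'_def
  proof (rule edge_colouring_insert[OF edge_colouring_mono[OF Cons.prems(1)]])
    fix f assume f: "f \<in> E - {{r, y}}" "{r, s} \<inter> f \<noteq> {}"
    then have "r \<in> f \<or> s \<in> f" by auto
    with f(1) uniq uniqs show "c f \<noteq> \<eta>" by blast
  qed (use Cons.prems \<eta>k in auto)
  \<comment> \<open>Only \<open>s\<close> loses a missing colour: at \<open>r\<close> the colour
    \<open>\<eta>\<close> merely changes its edge, while \<open>y\<close> gains it, whence an
    inclusion.\<close>
  have mis: "missing E k c z \<subseteq> missing E' k c' z" if "z \<noteq> s" for z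
  proof
    fix \<alpha> assume a: "\<alpha> \<in> missing E k c z"
    have "\<alpha> \<noteq> \<eta>" if "z = r"
      using a that ry unfolding missing_def \<eta>_def by blast
    then show "\<alpha> \<in> missing E' k c' z"
      using a \<open>z \<noteq> s\<close> by (auto simp: missing_def E'_def c'_def)
  qed
  have "\<exists>c''. edge_colouring (insert {r, y} E') k c''"
  proof (rule Cons.IH[OF col])
    show "{r, y} \<notin> E'" using dist by (auto simp: E'_def doubleton_eq_iff)
    show "r \<noteq> y" by (rule ney)
    show "\<forall>e\<in>E'. card e = 2" using Cons.prems(3,4) by (auto simp: E'_def)
    show "fan_path E' k c' r y ys"
    proof (rule fan_path_mono[OF path])
      fix z assume z: "z \<in> set ys" "{r, z} \<in> E"
      then have "z \<noteq> y" "z \<noteq> s" using dist by auto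
      then show "{r, z} \<in> E' \<and> c' {r, z} = c {r, z}"
        using z ysr by (auto simp: E'_def c'_def doubleton_eq_iff)
    next
      fix z assume "z \<in> set (y # ys)"
      then have "z \<noteq> s" using dist by auto
      then show "missing E k c z \<subseteq> missing E' k c' z" by (rule mis)
    qed
    show "distinct (y # ys)" using dist by auto
    show "\<mu> \<in> missing E' k c' r" using mis[OF Cons.prems(3)] Cons.prems(7) by blast
    have "last (y # ys) \<noteq> s"
      using dist last_in_set[of "y # ys"] by auto
    from subsetD[OF mis[OF this], of \<mu>] show "\<mu> \<in> missing E' k c' (last (y # ys))"
      using Cons.prems(8) by simp
  qed
  then show ?case by (simp add: ins)
qed

subsection \<open>Kempe chains\<close>

definition kempe :: "'a set set \<Rightarrow> ('a set \<Rightarrow> nat) \<Rightarrow> nat \<Rightarrow> nat \<Rightarrow> 'a \<Rightarrow> 'a set" where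
  "kempe E c \<mu> \<alpha> r = {x. (r, x) \<in> {(a, b). {a, b} \<in> E \<and> c {a, b} \<in> {\<mu>, \<alpha>}}\<^sup>*}"

text \<open>The exchange is made off \<open>K\<close>: with \<open>K\<close> the chain of
  \<open>r\<close>, every edge at \<open>r\<close> keeps its colour, so that fans at
  \<open>r\<close> can be compared before and after.\<close>

definition swap_off :: "'a set \<Rightarrow> ('a set \<Rightarrow> nat) \<Rightarrow> nat \<Rightarrow> nat \<Rightarrow> 'a set \<Rightarrow> nat" where
  "swap_off K c \<mu> \<alpha> e =
     (if e \<inter> K \<noteq> {} then c e else if c e = \<mu> then \<alpha> else if c e = \<alpha> then \<mu> else c e)"

lemma kempe_refl: "r \<in> kempe E c \<mu> \<alpha> r"
  by (simp add: kempe_def)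

lemma kempe_closed:
  assumes "e \<in> E" "card e = 2" "c e \<in> {\<mu>, \<alpha>}" "e \<inter> kempe E c \<mu> \<alpha> r \<noteq> {}"
  shows "e \<subseteq> kempe E c \<mu> \<alpha> r"
proof -
  obtain x where x: "x \<in> e" "x \<in> kempe E c \<mu> \<alpha> r" using assms by blast
  obtain a b where ab: "e = {a, b}" using assms(2) by (auto simp: card_2_iff)
  define y where "y = (if x = a then b else a)"
  have y: "e = {x, y}" using ab x(1) by (auto simp: y_def)
  have "y \<in> kempe E c \<mu> \<alpha> r"
    using rtrancl_into_rtrancl[of r x _ y] x(2) assms(1,3) unfolding kempe_def y by simp
  with x y show ?thesis by simp
qed

text \<open>A Kempe chain through \<open>r\<close>, where \<open>\<mu>\<close> is missing, is traversed by the deterministic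
  walk whose states are a vertex together with the colour of the next edge; any other end of the
  chain is a terminal state of this walk.\<close>

lemma kempe_end_unique:
  assumes col: "edge_colouring E k c"
    and r: "\<mu> \<in> missing E k c r"
    and x: "x \<in> kempe E c \<mu> \<alpha> r" "x \<noteq> r" "\<mu> \<in> missing E k c x \<or> \<alpha> \<in> missing E k c x"
    and y: "y \<in> kempe E c \<mu> \<alpha> r" "y \<noteq> r" "\<mu> \<in> missing E k c y \<or> \<alpha> \<in> missing E k c y"
  shows "x = y"
proof -
  define flip where "flip \<kappa> = (if \<kappa> = \<mu> then \<alpha> else \<mu>)" for \<kappa>
  define T where "T = {((u, \<kappa>), (w, \<kappa>')). {u, w} \<in> E \<and> c {u, w} = \<kappa> \<and> \<kappa> \<in> {\<mu>, \<alpha>} \<and> \<kappa>' = flip \<kappa>}"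
  have sv: "single_valued T"
  proof (rule single_valuedI, clarsimp simp: T_def)
    fix u v w
    assume "{u, v} \<in> E" "{u, w} \<in> E" "c {u, w} = c {u, v}"
    then show "v = w" using edge_colouring_same_colour[OF col, of u v w] by simp
  qed
  have visited: "\<exists>\<kappa>\<in>{\<mu>, \<alpha>}. ((r, \<alpha>), (z, \<kappa>)) \<in> T\<^sup>*" if "z \<in> kempe E c \<mu> \<alpha> r" for z
    using that unfolding kempe_def mem_Collect_eq
  proof (induction rule: rtrancl_induct)
    case base then show ?case by auto
  next
    case (step z w)
    then obtain \<kappa> where \<kappa>: "\<kappa> \<in> {\<mu>, \<alpha>}" "((r, \<alpha>), (z, \<kappa>)) \<in> T\<^sup>*" by blast
    have zw: "{z, w} \<in> E" "c {z, w} \<in> {\<mu>, \<alpha>}" using step by auto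
    show ?case
    proof (cases "c {z, w} = \<kappa>")
      case True
      then have "((z, \<kappa>), (w, flip \<kappa>)) \<in> T" using zw by (auto simp: T_def)
      with \<kappa>(2) have "((r, \<alpha>), (w, flip \<kappa>)) \<in> T\<^sup>*" by simp
      moreover have "flip \<kappa> \<in> {\<mu>, \<alpha>}" by (simp add: flip_def)
      ultimately show ?thesis by blast
    next
      \<comment> \<open>The edge is not the one the walk takes next. At the start its colour would
        be \<open>\<mu>\<close>, which \<open>r\<close> misses; later it is the edge just traversed,
        so \<open>w\<close> was visited one state earlier.\<close>
      case False
      from \<kappa>(2) show ?thesis
      proof (cases rule: rtranclE)
        case base
        then have "c {z, w} = \<mu>" using False zw by auto
        then show ?thesis using base r zw(1) by (auto simp: missing_def)
      next
        case (step p)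
        then obtain u \<kappa>' where p: "p = (u, \<kappa>')" "{u, z} \<in> E" "c {u, z} = \<kappa>'"
          "\<kappa>' \<in> {\<mu>, \<alpha>}" "\<kappa> = flip \<kappa>'" by (cases p) (auto simp: T_def)
        have zu: "{z, u} = {u, z}" by (rule insert_commute)
        have "c {z, w} = c {z, u}"
          using False zw(2) p unfolding zu by (simp add: flip_def split: if_splits)
        then have "w = u"
          using edge_colouring_same_colour[OF col, of z w u] zw(1) p(2) zu by simp
        then show ?thesis using step(1) p(1,4) by blast
      qed
    qed
  qed
  have terminal: "\<exists>\<kappa>. ((r, \<alpha>), (z, \<kappa>)) \<in> T\<^sup>* \<and> (z, \<kappa>) \<notin> Domain T"
    if z: "z \<in> kempe E c \<mu> \<alpha> r" "z \<noteq> r" "\<mu> \<in> missing E k c z \<or> \<alpha> \<in> missing E k c z" for z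
  proof -
    obtain \<kappa> where \<kappa>: "((r, \<alpha>), (z, \<kappa>)) \<in> T\<^sup>*" using visited z by blast
    from \<kappa> obtain p where p: "(p, (z, \<kappa>)) \<in> T" using z(2) by (cases rule: rtranclE) auto
    then obtain u \<kappa>' where u: "{u, z} \<in> E" "c {u, z} = \<kappa>'" "\<kappa>' \<in> {\<mu>, \<alpha>}" "\<kappa> = flip \<kappa>'"
      by (cases p) (auto simp: T_def)
    \<comment> \<open>The walk entered \<open>z\<close> through the colour \<open>\<kappa>'\<close>,
      so the colour missing at \<open>z\<close> is the other one and the walk cannot go on.\<close>
    have "\<kappa>' \<notin> missing E k c z" using u by (auto simp: missing_def)
    then have "\<kappa> \<in> missing E k c z" using z(3) u by (auto simp: flip_def)
    then have "(z, \<kappa>) \<notin> Domain T" unfolding T_def missing_def by blast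
    with \<kappa> show ?thesis by blast
  qed
  obtain \<kappa>1 where 1: "((r, \<alpha>), (x, \<kappa>1)) \<in> T\<^sup>*" "(x, \<kappa>1) \<notin> Domain T" using terminal x by blast
  obtain \<kappa>2 where 2: "((r, \<alpha>), (y, \<kappa>2)) \<in> T\<^sup>*" "(y, \<kappa>2) \<notin> Domain T" using terminal y by blast
  \<comment> \<open>Of two states reached by a deterministic walk, one leads to the other; as both
    are terminal, they are equal.\<close>
  from single_valued_confluent[OF sv 1(1) 2(1)] show "x = y"
  proof
    assume "((x, \<kappa>1), (y, \<kappa>2)) \<in> T\<^sup>*"
    then show ?thesis using 1(2) by (cases rule: converse_rtranclE) (auto simp: Domain_iff)
  next
    assume "((y, \<kappa>2), (x, \<kappa>1)) \<in> T\<^sup>*"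
    then show ?thesis using 2(2) by (cases rule: converse_rtranclE) (auto simp: Domain_iff)
  qed
qed

locale kempe_swap =
  fixes E :: "'a set set" and k :: nat and c c' :: "'a set \<Rightarrow> nat" and \<mu> \<alpha> :: nat and r :: 'a
    and K :: "'a set"
  assumes col: "edge_colouring E k c"
    and card2: "\<forall>e\<in>E. card e = 2"
    and k: "\<mu> < k" "\<alpha> < k"
    and K_def: "K = kempe E c \<mu> \<alpha> r"
    and c'_def: "c' = swap_off K c \<mu> \<alpha>"
begin

lemma r_in: "r \<in> K"
  by (simp add: K_def kempe_refl)

lemma closed: "e \<in> E \<Longrightarrow> c e \<in> {\<mu>, \<alpha>} \<Longrightarrow> e \<inter> K \<noteq> {} \<Longrightarrow> e \<subseteq> K"
  unfolding K_def using card2 by (intro kempe_closed) auto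

lemma same_in: "x \<in> K \<Longrightarrow> x \<in> e \<Longrightarrow> c' e = c e"
  by (auto simp: c'_def swap_off_def)

lemma same_other: "c e \<noteq> \<mu> \<Longrightarrow> c e \<noteq> \<alpha> \<Longrightarrow> c' e = c e"
  by (auto simp: c'_def swap_off_def)

lemma out: "x \<notin> K \<Longrightarrow> e \<in> E \<Longrightarrow> x \<in> e \<Longrightarrow>
    c' e = (if c e = \<mu> then \<alpha> else if c e = \<alpha> then \<mu> else c e)"
  using closed[of e] by (auto simp: c'_def swap_off_def)

lemma colouring: "edge_colouring E k c'"
  unfolding edge_colouring_def
proof (intro conjI ballI impI)
  show "c' ` E \<subseteq> {..<k}" using col k by (auto simp: edge_colouring_def c'_def swap_off_def)
  fix e f assume ef: "e \<in> E" "f \<in> E" "e \<noteq> f \<and> e \<inter> f \<noteq> {}"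
  then obtain x where x: "x \<in> e" "x \<in> f" by blast
  have ne: "c e \<noteq> c f" using ef col by (auto simp: edge_colouring_def)
  show "c' e \<noteq> c' f"
  proof (cases "x \<in> K")
    case True then show ?thesis using same_in x ne by metis
  next
    case False then show ?thesis using out x ef ne by auto
  qed
qed

lemma missing_in: "x \<in> K \<Longrightarrow> missing E k c' x = missing E k c x"
  unfolding missing_def using same_in by auto

lemma missing_out:
  assumes "x \<notin> K"
  shows "\<beta> \<in> missing E k c' x \<longleftrightarrow>
    (if \<beta> = \<mu> then \<alpha> else if \<beta> = \<alpha> then \<mu> else \<beta>) \<in> missing E k c x"
proof -
  have "c' e = \<beta> \<longleftrightarrow> c e = (if \<beta> = \<mu> then \<alpha> else if \<beta> = \<alpha> then \<mu> else \<beta>)"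
    if "e \<in> E" "x \<in> e" for e
    using out[OF assms that] by auto
  then show ?thesis using k by (auto simp: missing_def)
qed

lemma missing_neither:
  assumes "\<mu> \<notin> missing E k c x" "\<alpha> \<notin> missing E k c x"
  shows "missing E k c' x = missing E k c x"
proof (cases "x \<in> K")
  case False
  show ?thesis
  proof (rule set_eqI)
    fix \<beta> show "\<beta> \<in> missing E k c' x \<longleftrightarrow> \<beta> \<in> missing E k c x"
      using missing_out[OF False, of \<beta>] assms by (simp split: if_splits)
  qed
qed (rule missing_in)

text \<open>The exchange only permutes the two colours, so the test can be made after it as well.
  This form serves when only the later colouring is known to avoid them.\<close>

lemma missing_neither':
  assumes "\<mu> \<notin> missing E k c' x" "\<alpha> \<notin> missing E k c' x"
  shows "missing E k c' x = missing E k c x"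
proof (cases "x \<in> K")
  case False
  show ?thesis
    using missing_out[OF False, of \<mu>] missing_out[OF False, of \<alpha>] assms
    by (intro missing_neither) (auto split: if_splits)
qed (rule missing_in)

end

subsection \<open>Fans at an uncoloured edge\<close>

text \<open>No colouring is fixed, as the argument passes through several colourings of the same
  \<open>E\<close>. The uncoloured edge is a parameter too: besides the critical edge, a pair
  joining \<open>r\<close> to a non-neighbour is used.\<close>

locale uncoloured_edge =
  fixes E :: "'a set set" and k :: nat and r s :: 'a
  assumes finE: "finite E" and card2: "\<forall>e\<in>E. card e = 2"
    and rs: "{r, s} \<notin> E" "r \<noteq> s"
    and uncolourable: "\<nexists>c. edge_colouring (insert {r, s} E) k c"
begin

text \<open>\<open>s\<close> is added by hand because \<open>{r, s}\<close> bears no colour.\<close>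

definition fans :: "('a set \<Rightarrow> nat) \<Rightarrow> 'a set" where
  "fans c = insert s (fan E k c r (missing E k c s))"

lemma s_in_fans: "s \<in> fans c"
  by (simp add: fans_def)

lemma fan_subset_fans: "\<alpha> \<in> missing E k c s \<Longrightarrow> fan E k c r {\<alpha>} \<subseteq> fans c"
  using fan_mono[of "{\<alpha>}" "missing E k c s" E k c r] by (auto simp: fans_def)

lemma s_notin_fan: "s \<notin> fan E k c r A"
  using fan_edge rs by metis

lemma r_notin_fans: "r \<notin> fans c"
proof
  assume "r \<in> fans c"
  then have "r \<in> fan E k c r (missing E k c s)" using rs(2) by (simp add: fans_def)
  from bspec[OF card2 fan_edge[OF this]] show False by simp
qed

lemma notin_fans: "{r, v} \<notin> E \<Longrightarrow> v \<noteq> s \<Longrightarrow> v \<notin> fans c"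
  by (auto simp: fans_def dest: fan_edge)

text \<open>Otherwise shifting colours along a fan path from \<open>s\<close> to \<open>y\<close>
  would leave \<open>\<mu>\<close> free for the last uncoloured edge, and all edges would be
  coloured.\<close>

lemma fans_avoid_missing_r:
  assumes "edge_colouring E k c" "\<mu> \<in> missing E k c r" "y \<in> fans c"
  shows "\<mu> \<notin> missing E k c y"
proof
  assume \<mu>: "\<mu> \<in> missing E k c y"
  have "\<exists>ys. fan_path E k c r s ys \<and> distinct (s # ys) \<and> last (s # ys) = y"
  proof (cases "y = s")
    case True then show ?thesis by (intro exI[of _ "[]"]) auto
  next
    case False
    then have "y \<in> fan E k c r (missing E k c s)" using assms(3) by (simp add: fans_def)
    then show ?thesis using rs by (intro fan_path_exists)
  qed
  then obtain ys where "fan_path E k c r s ys" "distinct (s # ys)" "last (s # ys) = y" by blast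
  with colourable_if_fan_path[OF assms(1) rs card2] assms(2) \<mu> uncolourable show False by metis
qed

text \<open>Otherwise exchange the two colours on all chains avoiding \<open>r\<close>: following the fan to \<open>y\<close> in the
  new colouring, one meets a vertex missing \<open>\<mu>\<close>.\<close>

lemma fans_linked:
  assumes col: "edge_colouring E k c" and \<mu>: "\<mu> \<in> missing E k c r"
    and y: "y \<in> fans c" and \<alpha>: "\<alpha> \<in> missing E k c y"
  shows "y \<in> kempe E c \<mu> \<alpha> r"
proof (rule ccontr)
  define K where "K = kempe E c \<mu> \<alpha> r"
  define c' where "c' = swap_off K c \<mu> \<alpha>"
  assume yK: "y \<notin> kempe E c \<mu> \<alpha> r"
  interpret kempe_swap E k c c' \<mu> \<alpha> r K
    using col card2 \<mu> \<alpha> by unfold_locales (auto simp: K_def c'_def missing_def)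
  have \<mu>': "\<mu> \<in> missing E k c' r" using \<mu> missing_in[OF r_in] by simp
  \<comment> \<open>A vertex in both fans misses \<open>\<mu>\<close> in neither colouring. If it
    lay outside \<open>K\<close> and missed \<open>\<alpha>\<close>, the exchange would make it miss
    \<open>\<mu>\<close>; so the exchange costs it no missing colour.\<close>
  have miss: "missing E k c x \<subseteq> missing E k c' x" if "x \<in> fans c" "x \<in> fans c'" for x
  proof -
    have "\<mu> \<notin> missing E k c x" by (rule fans_avoid_missing_r[OF col \<mu> that(1)])
    moreover have "\<mu> \<notin> missing E k c' x" by (rule fans_avoid_missing_r[OF colouring \<mu>' that(2)])
    ultimately show ?thesis
      using missing_neither[of x] missing_in[of x] missing_out[of x \<mu>]
      by (cases "x \<in> K"; cases "\<alpha> \<in> missing E k c x") auto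
  qed
  have sub: "z \<in> fans c'" if "z \<in> fan E k c r (missing E k c s)" for z
    using that
  proof (induction rule: fan.induct)
    case (start z)
    then have "c' {r, z} \<in> missing E k c' s"
      using miss[of s] same_in[OF r_in, of "{r, z}"] by (auto simp: fans_def)
    with start show ?case by (auto simp: fans_def intro: fan.start)
  next
    case (step x z)
    then have "c' {r, z} \<in> missing E k c' x"
      using miss[of x] same_in[OF r_in, of "{r, z}"] by (auto simp: fans_def)
    with step show ?case by (auto simp: fans_def intro: fan.intros)
  qed
  have y': "y \<in> fans c'" using y sub by (auto simp: fans_def)
  have "\<mu> \<in> missing E k c' y"
    using missing_out[of y \<mu>] yK \<alpha> by (simp add: K_def)
  with fans_avoid_missing_r[OF colouring \<mu>' y'] show False by blast
qed

text \<open>For a shared missing colour, \<open>x\<close> and \<open>y\<close> would both lie on the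
  chain through \<open>r\<close> and both be its end other than \<open>r\<close>.\<close>

lemma fans_elementary:
  assumes col: "edge_colouring E k c" and \<mu>: "\<mu> \<in> missing E k c r"
    and "x \<in> fans c" "y \<in> fans c" "x \<noteq> y"
  shows "missing E k c x \<inter> missing E k c y = {}"
proof (rule ccontr)
  assume "missing E k c x \<inter> missing E k c y \<noteq> {}"
  then obtain \<alpha> where "\<alpha> \<in> missing E k c x" "\<alpha> \<in> missing E k c y" by blast
  moreover have "x \<noteq> r" "y \<noteq> r" using assms(3,4) r_notin_fans[of c] by auto
  ultimately have "x = y"
    using kempe_end_unique[OF col \<mu>, of x \<alpha> y] fans_linked[OF col \<mu>] assms(3,4) by simp
  with assms(5) show False ..
qed

lemma finite_fan: "finite (fan E k c r A)"
proof (rule finite_subset)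
  show "fan E k c r A \<subseteq> \<Union>E"
  proof
    fix y assume "y \<in> fan E k c r A"
    then show "y \<in> \<Union>E" by (intro UnionI[OF fan_edge]) auto
  qed
  show "finite (\<Union>E)" using finE card2 by (intro finite_Union) (auto intro: card_ge_0_finite)
qed

lemma edge_at_r:
  assumes "\<eta> < k" "\<eta> \<notin> missing E k c r"
  obtains z where "{r, z} \<in> E" "c {r, z} = \<eta>"
proof -
  obtain e where e: "e \<in> E" "r \<in> e" "c e = \<eta>" using assms by (auto simp: missing_def)
  obtain a b where "e = {a, b}" using card2 e(1) by (metis card_2_iff)
  then have "e = {r, a} \<or> e = {r, b}" using e(2) by auto
  then show thesis using that e by metis
qed

text \<open>If every fan vertex missed a colour, these colours and \<open>\<alpha>\<close> would require more edges at
  \<open>r\<close> than the fan has.\<close>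

lemma fan_full_vertex:
  assumes col: "edge_colouring E k c" and \<mu>: "\<mu> \<in> missing E k c r"
    and \<alpha>: "\<alpha> \<in> missing E k c s"
  shows "\<exists>y\<in>fan E k c r {\<alpha>}. missing E k c y = {}"
proof (rule ccontr)
  define F where "F = fan E k c r {\<alpha>}"
  assume "\<not> ?thesis"
  then have "\<forall>y\<in>F. \<exists>\<eta>. \<eta> \<in> missing E k c y" by (auto simp: F_def)
  then obtain f where f: "\<And>y. y \<in> F \<Longrightarrow> f y \<in> missing E k c y" by metis
  have FR: "F \<subseteq> fans c" unfolding F_def by (rule fan_subset_fans[OF \<alpha>])
  have inj: "inj_on f F"
  proof (rule inj_onI, rule ccontr)
    fix x y assume "x \<in> F" "y \<in> F" "f x = f y" "x \<noteq> y"
    then show False using fans_elementary[OF col \<mu>, of x y] f[of x] f[of y] FR by auto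
  qed
  have \<alpha>f: "\<alpha> \<notin> f ` F"
  proof
    assume "\<alpha> \<in> f ` F"
    then obtain x where "x \<in> F" "\<alpha> \<in> missing E k c x" using f by blast
    moreover have "x \<noteq> s" using \<open>x \<in> F\<close> s_notin_fan by (auto simp: F_def)
    ultimately show False
      using fans_elementary[OF col \<mu>, of x s] \<alpha> FR s_in_fans by blast
  qed
  \<comment> \<open>Each of these colours is missing at a vertex of \<open>fans c\<close>, hence
    present at \<open>r\<close>, and the edge at \<open>r\<close> bearing it leads into
    \<open>F\<close> again. The left side has one element more than \<open>F\<close>.\<close>
  have "insert \<alpha> (f ` F) \<subseteq> (\<lambda>z. c {r, z}) ` F"
  proof
    fix \<eta> assume "\<eta> \<in> insert \<alpha> (f ` F)"
    then consider "\<eta> = \<alpha>" | y where "y \<in> F" "\<eta> = f y" by blast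
    then show "\<eta> \<in> (\<lambda>z. c {r, z}) ` F"
    proof cases
      case 1
      then have "\<eta> < k" "\<eta> \<notin> missing E k c r"
        using \<alpha> fans_avoid_missing_r[OF col _ s_in_fans] by (auto simp: missing_def)
      then obtain z where "{r, z} \<in> E" "c {r, z} = \<eta>" by (rule edge_at_r)
      then show ?thesis using 1 by (auto simp: F_def intro!: image_eqI[of _ _ z] fan.start)
    next
      case 2
      then have "\<eta> < k" "\<eta> \<notin> missing E k c r"
        using f[of y] fans_avoid_missing_r[OF col, of \<eta> y] FR by (auto simp: missing_def)
      then obtain z where z: "{r, z} \<in> E" "c {r, z} = \<eta>" by (rule edge_at_r)
      then have "z \<in> F" using 2 f[of y] fan.step[of y E k c r "{\<alpha>}" z] by (simp add: F_def)
      then show ?thesis using z by blast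
    qed
  qed
  then have "card (insert \<alpha> (f ` F)) \<le> card ((\<lambda>z. c {r, z}) ` F)"
    using finite_fan by (intro card_mono) (auto simp: F_def)
  also have "\<dots> \<le> card F" using finite_fan by (intro card_image_le) (auto simp: F_def)
  finally show False
    using \<alpha>f inj finite_fan by (simp add: card_image F_def)
qed

lemma fans_disjoint:
  assumes col: "edge_colouring E k c" and \<mu>: "\<mu> \<in> missing E k c r"
    and \<alpha>: "\<alpha> \<in> missing E k c s" and \<beta>: "\<beta> \<in> missing E k c s" and "\<alpha> \<noteq> \<beta>"
  shows "fan E k c r {\<alpha>} \<inter> fan E k c r {\<beta>} = {}"
proof (rule fan_disjoint[OF \<open>\<alpha> \<noteq> \<beta>\<close>])
  have el: "\<eta> \<notin> missing E k c x"
    if "\<eta> \<in> missing E k c s" "\<theta> \<in> missing E k c s" "x \<in> fan E k c r {\<theta>}" for \<eta> \<theta> x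
  proof -
    have "x \<in> fans c" using that fan_subset_fans by blast
    moreover have "x \<noteq> s" using that s_notin_fan by metis
    ultimately show ?thesis using fans_elementary[OF col \<mu>, of x s] s_in_fans that(1) by blast
  qed
  show "\<alpha> \<notin> missing E k c y" if "y \<in> fan E k c r {\<beta>}" for y
    using el[OF \<alpha> \<beta> that] .
  show "\<beta> \<notin> missing E k c y" if "y \<in> fan E k c r {\<alpha>}" for y
    using el[OF \<beta> \<alpha> that] .
  show "missing E k c x \<inter> missing E k c y = {}"
    if "x \<in> fan E k c r {\<alpha>}" "y \<in> fan E k c r {\<beta>}" "x \<noteq> y" for x y
    using fans_elementary[OF col \<mu>, of x y] fan_subset_fans[OF \<alpha>] fan_subset_fans[OF \<beta>] that
    by blast
qed

text \<open>The chain through \<open>r\<close> ends at \<open>s\<close>, so \<open>v\<close>, which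
  also misses one of the two colours, lies on another chain. Exchanging the colours off the chain of
  \<open>r\<close> therefore changes what \<open>v\<close> misses, but neither the edges at
  \<open>r\<close> nor the colours missing on the fan.\<close>

lemma switch:
  assumes col: "edge_colouring E k c" and \<mu>: "\<mu> \<in> missing E k c r"
    and \<alpha>: "\<alpha> \<in> missing E k c s"
    and v: "v \<noteq> r" "v \<noteq> s" "\<mu> \<in> missing E k c v \<or> \<alpha> \<in> missing E k c v"
  obtains c' where "edge_colouring E k c'"
    and "\<And>y. c' {r, y} = c {r, y}"
    and "\<And>e. c e \<noteq> \<mu> \<Longrightarrow> c e \<noteq> \<alpha> \<Longrightarrow> c' e = c e"
    and "missing E k c' r = missing E k c r"
    and "\<And>x. x \<in> fans c \<Longrightarrow> missing E k c' x = missing E k c x"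
    and "\<mu> \<in> missing E k c v \<Longrightarrow> \<alpha> \<in> missing E k c' v"
    and "\<alpha> \<in> missing E k c v \<Longrightarrow> \<mu> \<in> missing E k c' v"
    and "\<And>x. \<mu> \<notin> missing E k c' x \<Longrightarrow> \<alpha> \<notin> missing E k c' x \<Longrightarrow>
           missing E k c' x = missing E k c x"
proof -
  define K where "K = kempe E c \<mu> \<alpha> r"
  define c' where "c' = swap_off K c \<mu> \<alpha>"
  interpret kempe_swap E k c c' \<mu> \<alpha> r K
    using col card2 \<mu> \<alpha> by unfold_locales (auto simp: K_def c'_def missing_def)
  have "s \<in> K" unfolding K_def by (rule fans_linked[OF col \<mu> s_in_fans \<alpha>])
  then have vK: "v \<notin> K"
    using kempe_end_unique[OF col \<mu>, of s \<alpha> v] \<alpha> v rs(2) unfolding K_def by metis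
  have fans: "missing E k c' x = missing E k c x" if "x \<in> fans c" for x
  proof (cases "\<alpha> \<in> missing E k c x")
    case True
    then have "x \<in> K" unfolding K_def by (rule fans_linked[OF col \<mu> that])
    then show ?thesis by (rule missing_in)
  next
    case False
    then show ?thesis using missing_neither fans_avoid_missing_r[OF col \<mu> that] by blast
  qed
  show thesis
  proof (rule that[of c'])
    show "c' {r, y} = c {r, y}" for y using same_in[OF r_in] by simp
    show "\<mu> \<in> missing E k c v \<Longrightarrow> \<alpha> \<in> missing E k c' v"
      using missing_out[OF vK, of \<alpha>] by (auto split: if_splits)
    show "\<alpha> \<in> missing E k c v \<Longrightarrow> \<mu> \<in> missing E k c' v"
      using missing_out[OF vK, of \<mu>] by auto
  qed (use colouring same_other missing_in[OF r_in] fans missing_neither' in auto)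
qed

lemma fan_switch:
  assumes "\<And>y. c' {r, y} = c {r, y}" "\<And>x. x \<in> fans c \<Longrightarrow> missing E k c' x = missing E k c x"
    and "A \<subseteq> missing E k c s"
  shows "fan E k c' r A = fan E k c r A"
proof (rule fan_cong)
  fix x assume "x \<in> fan E k c r A"
  then have "x \<in> fans c" using fan_mono[OF assms(3), of E k c r] by (auto simp: fans_def)
  then show "missing E k c' x = missing E k c x" by (rule assms(2))
qed (rule assms(1))

lemma fans_switch:
  assumes "\<And>y. c' {r, y} = c {r, y}" "\<And>x. x \<in> fans c \<Longrightarrow> missing E k c' x = missing E k c x"
  shows "fans c' = fans c"
  using fan_switch[OF assms order_refl] assms(2)[OF s_in_fans] by (simp add: fans_def)

end

section \<open>A neighbour \<open>v\<close> of \<open>s\<close> that is not joined to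
  \<open>r\<close>\<close>

locale uncoloured_edge_path = uncoloured_edge +
  fixes v
  assumes sv: "{s, v} \<in> E" and vr: "v \<noteq> r" "{r, v} \<notin> E"
begin

lemma v_ne_s: "v \<noteq> s"
  using bspec[OF card2 sv] by auto

lemma v_notin_fan: "v \<notin> fan E k c r A"
  using fan_edge vr(2) by metis

text \<open>Here \<open>s\<close> trades \<open>\<beta>\<close> for the old colour of
  \<open>{s, v}\<close>. The fans at \<open>r\<close> survive because \<open>{s, v}\<close> is not
  an edge at \<open>r\<close>, and neither \<open>s\<close> nor \<open>v\<close> is joined to
  \<open>r\<close> in \<open>E\<close>, so neither belongs to such a fan.\<close>

lemma recolour:
  assumes col: "edge_colouring E k c"
    and \<beta>: "\<beta> \<in> missing E k c s" "\<beta> \<in> missing E k c v"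
  obtains c' where "edge_colouring E k c'" "c' {s, v} = \<beta>" "c {s, v} \<in> missing E k c' v"
    "missing E k c' s = insert (c {s, v}) (missing E k c s - {\<beta>})"
    "\<And>x. x \<noteq> s \<Longrightarrow> x \<noteq> v \<Longrightarrow> missing E k c' x = missing E k c x"
    "\<And>A. fan E k c' r A = fan E k c r A"
proof -
  define c' where "c' = c({s, v} := \<beta>)"
  define E' where "E' = E - {{s, v}}"
  have E: "E = insert {s, v} E'" using sv by (auto simp: E'_def)
  have \<beta>k: "\<beta> < k" using \<beta> by (simp add: missing_def)
  have \<gamma>k: "c {s, v} < k" using col sv by (auto simp: edge_colouring_def)
  have col': "edge_colouring E k c'"
    unfolding c'_def by (subst E, rule edge_colouring_insert)
      (use edge_colouring_mono[OF col] \<beta> \<beta>k in \<open>auto simp: E'_def missing_def\<close>)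
  have \<gamma>: "c e \<noteq> c {s, v}" if "e \<in> E" "e \<noteq> {s, v}" "s \<in> e \<or> v \<in> e" for e
  proof -
    have "e \<inter> {s, v} \<noteq> {}" using that(3) by auto
    then show ?thesis using col that sv unfolding edge_colouring_def by metis
  qed
  have \<beta>\<gamma>: "\<beta> \<noteq> c {s, v}" using \<beta> sv by (auto simp: missing_def)
  have e: "x \<in> {s, v} \<Longrightarrow> missing E k c' x = insert (c {s, v}) (missing E k c x - {\<beta>})" for x
  proof (rule set_eqI)
    fix \<eta> assume x: "x \<in> {s, v}"
    consider "\<eta> = \<beta>" | "\<eta> = c {s, v}" | "\<eta> \<noteq> \<beta>" "\<eta> \<noteq> c {s, v}" by blast
    then show "\<eta> \<in> missing E k c' x \<longleftrightarrow> \<eta> \<in> insert (c {s, v}) (missing E k c x - {\<beta>})"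
    proof cases
      case 1
      have "c' {s, v} = \<beta>" by (simp add: c'_def)
      then have "\<eta> \<notin> missing E k c' x" using 1 sv x unfolding missing_def by blast
      then show ?thesis using 1 \<beta>\<gamma> by simp
    next
      case 2
      then show ?thesis using \<gamma> x \<gamma>k \<beta>\<gamma> by (auto simp: missing_def c'_def)
    next
      case 3
      then show ?thesis by (auto simp: missing_def c'_def)
    qed
  qed
  have m: "missing E k c' x = missing E k c x" if "x \<noteq> s" "x \<noteq> v" for x
    using that by (auto simp: missing_def c'_def)
  have f: "fan E k c' r A = fan E k c r A" for A
  proof (rule fan_cong)
    show "c' {r, y} = c {r, y}" for y using rs(2) vr(1) by (auto simp: c'_def doubleton_eq_iff)
    show "missing E k c' x = missing E k c x" if "x \<in> fan E k c r A" for x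
      using that s_notin_fan v_notin_fan m by metis
  qed
  show thesis
    by (rule that[of c']) (use col' e m f in \<open>auto simp: c'_def\<close>)
qed

text \<open>Otherwise \<open>{s, v}\<close> can be recoloured so that its old colour becomes missing
  at \<open>s\<close>, while \<open>x\<close> stays in the fan and still misses it, against
  \<open>fans_elementary\<close>.\<close>

lemma path_colour_not_missing_on_fans:
  assumes col: "edge_colouring E k c" and \<mu>: "\<mu> \<in> missing E k c r" "\<mu> \<in> missing E k c v"
    and ab: "a \<in> missing E k c s" "b \<in> missing E k c s" "a \<noteq> b"
    and x: "x \<in> fans c"
  shows "c {s, v} \<notin> missing E k c x"
proof
  define \<gamma> where "\<gamma> = c {s, v}"
  assume "c {s, v} \<in> missing E k c x"
  then have \<gamma>x: "\<gamma> \<in> missing E k c x" by (simp add: \<gamma>_def)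
  have \<gamma>s: "\<gamma> \<notin> missing E k c s" "\<gamma> \<noteq> \<mu>" using sv \<mu>(2) by (auto simp: missing_def \<gamma>_def)
  then have xs: "x \<noteq> s" using \<gamma>x by blast
  then have "x \<in> fan E k c r (missing E k c s)" using x by (simp add: fans_def)
  from fan_singleton[OF this]
  obtain \<theta> where \<theta>: "\<theta> \<in> missing E k c s" "x \<in> fan E k c r {\<theta>}" by blast
  \<comment> \<open>Both missing colours of \<open>s\<close> are put to work:
    \<open>\<theta>\<close> keeps \<open>x\<close> in the fan, while \<open>\<beta>\<close> is given
    up to \<open>{s, v}\<close>.\<close>
  obtain \<beta> where \<beta>: "\<beta> \<in> missing E k c s" "\<beta> \<noteq> \<theta>" using ab by metis
  obtain c1 where c1: "edge_colouring E k c1" "\<And>y. c1 {r, y} = c {r, y}"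
    "\<And>e. c e \<noteq> \<mu> \<Longrightarrow> c e \<noteq> \<beta> \<Longrightarrow> c1 e = c e" "missing E k c1 r = missing E k c r"
    "\<And>x. x \<in> fans c \<Longrightarrow> missing E k c1 x = missing E k c x" "\<beta> \<in> missing E k c1 v"
    using switch[OF col \<mu>(1) \<beta>(1) vr(1) v_ne_s] \<mu>(2) by metis
  have c1sv: "c1 {s, v} = \<gamma>" using c1(3)[of "{s, v}"] \<gamma>s \<beta>(1) by (auto simp: \<gamma>_def)
  have c1s: "missing E k c1 s = missing E k c s" by (rule c1(5)[OF s_in_fans])
  have f1: "fan E k c1 r {\<theta>} = fan E k c r {\<theta>}" using \<theta>(1) by (intro fan_switch c1) auto
  obtain c2 where c2: "edge_colouring E k c2"
    "missing E k c2 s = insert \<gamma> (missing E k c s - {\<beta>})"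
    "\<And>x. x \<noteq> s \<Longrightarrow> x \<noteq> v \<Longrightarrow> missing E k c2 x = missing E k c1 x"
    "\<And>A. fan E k c2 r A = fan E k c1 r A"
    using recolour[OF c1(1), of \<beta>] \<beta>(1) c1(6) c1s c1sv by metis
  have "x \<in> fan E k c2 r {\<theta>}" using \<theta>(2) c2(4) f1 by simp
  then have x2: "x \<in> fans c2" using fan_subset_fans[of \<theta> c2] c2(2) \<theta>(1) \<beta>(2) by auto
  have "x \<noteq> v" using \<theta>(2) v_notin_fan by metis
  then have "\<gamma> \<in> missing E k c2 x" using c2(3) c1(5) x xs \<gamma>x by simp
  moreover have "\<mu> \<in> missing E k c2 r" using c2(3)[of r] c1(4) \<mu>(1) rs(2) vr(1) by simp
  ultimately show False using fans_elementary[OF c2(1) _ x2 s_in_fans xs] c2(2) by blast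
qed

text \<open>The colour \<open>\<mu>\<close> missing at \<open>v\<close> can be exchanged for \<open>a\<close> and \<open>sv\<close> recoloured with \<open>a\<close>; then \<open>s\<close>
  misses the old colour of \<open>sv\<close>. Neither change affects the fan started by that colour.\<close>

lemma fan_of_path_colour:
  assumes col: "edge_colouring E k c" and \<mu>: "\<mu> \<in> missing E k c r" "\<mu> \<in> missing E k c v"
    and ab: "a \<in> missing E k c s" "b \<in> missing E k c s" "a \<noteq> b"
  shows "fan E k c r {c {s, v}} \<inter> fan E k c r {b} = {}"
    and "\<exists>y\<in>fan E k c r {c {s, v}}. missing E k c y = {}"
proof -
  define \<gamma> where "\<gamma> = c {s, v}"
  have \<gamma>s: "\<gamma> \<notin> missing E k c s" "\<gamma> \<noteq> \<mu>" using sv \<mu>(2) by (auto simp: missing_def \<gamma>_def)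
  then have \<gamma>ab: "\<gamma> \<noteq> a" "\<gamma> \<noteq> b" using ab by auto
  have a\<mu>: "a \<noteq> \<mu>" using fans_avoid_missing_r[OF col \<mu>(1) s_in_fans] ab by blast
  obtain c1 where c1: "edge_colouring E k c1" "\<And>y. c1 {r, y} = c {r, y}"
    "\<And>e. c e \<noteq> \<mu> \<Longrightarrow> c e \<noteq> a \<Longrightarrow> c1 e = c e" "missing E k c1 r = missing E k c r"
    "\<And>x. x \<in> fans c \<Longrightarrow> missing E k c1 x = missing E k c x" "a \<in> missing E k c1 v"
    "\<And>x. \<mu> \<notin> missing E k c1 x \<Longrightarrow> a \<notin> missing E k c1 x \<Longrightarrow>
           missing E k c1 x = missing E k c x"
    using switch[OF col \<mu>(1) ab(1) vr(1) v_ne_s] \<mu>(2) by metis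
  have c1sv: "c1 {s, v} = \<gamma>" using c1(3)[of "{s, v}"] \<gamma>s \<gamma>ab by (auto simp: \<gamma>_def)
  have c1s: "missing E k c1 s = missing E k c s" by (rule c1(5)[OF s_in_fans])
  have f1: "fan E k c1 r {b} = fan E k c r {b}" using ab by (intro fan_switch c1) auto
  obtain c2 where c2: "edge_colouring E k c2" "c2 {s, v} = a" "\<gamma> \<in> missing E k c2 v"
    "missing E k c2 s = insert \<gamma> (missing E k c s - {a})"
    "\<And>x. x \<noteq> s \<Longrightarrow> x \<noteq> v \<Longrightarrow> missing E k c2 x = missing E k c1 x"
    "\<And>A. fan E k c2 r A = fan E k c1 r A"
    using recolour[OF c1(1), of a] ab c1(6) c1s c1sv by metis
  have c2s: "\<gamma> \<in> missing E k c2 s" "b \<in> missing E k c2 s" using c2(4) ab by auto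
  have \<mu>2: "\<mu> \<in> missing E k c2 r" using c2(5)[of r] c1(4) \<mu>(1) rs(2) vr(1) by simp
  \<comment> \<open>Under \<open>c2\<close> the colour of \<open>{s, v}\<close> is \<open>a\<close>.
    A further exchange of \<open>\<mu>\<close> and \<open>\<gamma>\<close> makes
    \<open>\<mu>\<close> missing at \<open>v\<close>, and then the preceding lemma applies with
    \<open>\<gamma>\<close> and \<open>b\<close> as colours missing at \<open>s\<close>.\<close>
  have a2: "a \<notin> missing E k c2 x" if "x \<in> fans c2" for x
  proof -
    obtain c3 where c3: "edge_colouring E k c3" "\<And>y. c3 {r, y} = c2 {r, y}"
      "\<And>e. c2 e \<noteq> \<mu> \<Longrightarrow> c2 e \<noteq> \<gamma> \<Longrightarrow> c3 e = c2 e" "missing E k c3 r = missing E k c2 r"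
      "\<And>x. x \<in> fans c2 \<Longrightarrow> missing E k c3 x = missing E k c2 x" "\<mu> \<in> missing E k c3 v"
      using switch[OF c2(1) \<mu>2 c2s(1) vr(1) v_ne_s] c2(3) by metis
    have "c3 {s, v} = a" using c3(3)[of "{s, v}"] c2(2) a\<mu> \<gamma>ab by auto
    moreover have "fans c3 = fans c2" by (intro fans_switch c3)
    ultimately show ?thesis
      using path_colour_not_missing_on_fans[OF c3(1) _ c3(6), of \<gamma> b x]
        c3(4,5) that \<mu>2 c2s \<gamma>ab s_in_fans by metis
  qed
  \<comment> \<open>Vertices of this fan miss neither \<open>\<mu>\<close> nor \<open>a\<close>, so
    the exchange from \<open>c\<close> to \<open>c1\<close> leaves their missing colours alone; the
    recolouring affects only \<open>s\<close> and \<open>v\<close>, which lie in no fan.\<close>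
  have same: "missing E k c x = missing E k c2 x \<and> missing E k c x = missing E k c1 x"
    if "x \<in> fan E k c2 r {\<gamma>}" for x
  proof -
    have x: "x \<in> fans c2" using that fan_subset_fans[OF c2s(1)] by blast
    have "x \<noteq> s" "x \<noteq> v" using that s_notin_fan v_notin_fan by metis+
    then have eq: "missing E k c2 x = missing E k c1 x" by (rule c2(5))
    with fans_avoid_missing_r[OF c2(1) \<mu>2 x] a2[OF x] c1(7)[of x] show ?thesis by simp
  qed
  have f\<gamma>: "fan E k c r {\<gamma>} = fan E k c2 r {\<gamma>}"
    unfolding c2(6) by (rule fan_cong) (use c1(2) same c2(6) in auto)
  show "fan E k c r {c {s, v}} \<inter> fan E k c r {b} = {}"
    using fans_disjoint[OF c2(1) \<mu>2 c2s \<gamma>ab(2)] f\<gamma> f1 c2(6) by (simp add: \<gamma>_def)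
  show "\<exists>y\<in>fan E k c r {c {s, v}}. missing E k c y = {}"
    using fan_full_vertex[OF c2(1) \<mu>2 c2s(1)] f\<gamma> same by (auto simp: \<gamma>_def)
qed

end

subsection \<open>Counting full neighbours of \<open>r\<close>\<close>

text \<open>Each of the \<open>k\<close> colours occurs on an edge at \<open>x\<close> or is missing
  there. The bound serves in two ways: few neighbours force missing colours, and no missing colour
  forces at least \<open>k\<close> neighbours.\<close>

lemma card_missing:
  assumes "finite E" "\<forall>e\<in>E. card e = 2"
  shows "k \<le> card {w. {x, w} \<in> E} + card (missing E k c x)"
proof -
  let ?N = "{w. {x, w} \<in> E}"
  have fin: "finite ?N"
  proof (rule finite_subset)
    show "?N \<subseteq> \<Union>E" by blast
    show "finite (\<Union>E)" using assms by (intro finite_Union) (auto intro: card_ge_0_finite)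
  qed
  have "{..<k} \<subseteq> (\<lambda>w. c {x, w}) ` ?N \<union> missing E k c x"
  proof
    fix \<eta> assume \<eta>: "\<eta> \<in> {..<k}"
    show "\<eta> \<in> (\<lambda>w. c {x, w}) ` ?N \<union> missing E k c x"
    proof (cases "\<eta> \<in> missing E k c x")
      case False
      then obtain e where e: "e \<in> E" "x \<in> e" "c e = \<eta>" using \<eta> by (auto simp: missing_def)
      obtain p q where "e = {p, q}" using assms(2) e(1) by (metis card_2_iff)
      then have "e = {x, p} \<or> e = {x, q}" using e(2) by auto
      then show ?thesis using e by blast
    qed simp
  qed
  moreover have "finite (missing E k c x)" by (simp add: missing_def)
  ultimately have "card {..<k} \<le> card ((\<lambda>w. c {x, w}) ` ?N \<union> missing E k c x)"
    using fin by (intro card_mono) auto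
  also have "\<dots> \<le> card ((\<lambda>w. c {x, w}) ` ?N) + card (missing E k c x)" by (rule card_Un_le)
  also have "\<dots> \<le> card ?N + card (missing E k c x)" using card_image_le[OF fin] by simp
  finally show ?thesis by simp
qed

text \<open>Deleting \<open>e\<close> brings the index down to at most \<Delta>, and a colouring
  with fewer colours also counts as one with the palette of size \<Delta>.\<close>

lemma critical_edge_colouring:
  assumes "simple_graph G" "class2 G" "critical_edge G e"
  shows "\<exists>c. edge_colouring (edges G - {e}) (max_degree G) c"
    and "\<nexists>c. edge_colouring (edges G) (max_degree G) c"
proof -
  have \<chi>: "chromatic_index G = max_degree G + 1" using assms(2) by (simp add: class2_def)
  have "chromatic_index (delete_edge G e) \<le> max_degree G"
    using assms(3) \<chi> by (simp add: critical_edge_def)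
  moreover obtain c
    where "proper_edge_coloring (delete_edge G e) (chromatic_index (delete_edge G e)) c"
    using chromatic_index_attained[OF simple_graph_delete_edge[OF assms(1)]] by blast
  ultimately have "edge_colouring (edges G - {e}) (max_degree G) c"
    by (fastforce simp: proper_edge_coloring_def edge_colouring_def delete_edge_def)
  then show "\<exists>c. edge_colouring (edges G - {e}) (max_degree G) c" by blast
  show "\<nexists>c. edge_colouring (edges G) (max_degree G) c"
  proof
    assume "\<exists>c. edge_colouring (edges G) (max_degree G) c"
    then have "\<exists>c. proper_edge_coloring G (max_degree G) c"
      by (simp add: edge_colouring_def proper_edge_coloring_def)
    then have "chromatic_index G \<le> max_degree G"
      unfolding chromatic_index_def by (rule Least_le)
    then show False using \<chi> by simp
  qed
qed

theorem theorem1p4: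
  fixes G :: "'a graph" and \<Delta> :: nat and r :: 'a
  assumes "simple_graph G"
    and "class2 G"
    and "max_degree G = \<Delta>"
    and "r \<in> verts G"
    and "k_vertex G \<Delta> r"
    and "light G r"
  shows "\<forall>s \<in> neighbors G r. degree G s < \<Delta> \<longrightarrow> critical_edge G {r, s} \<longrightarrow>
           (\<forall>v \<in> neighbors G s - neighbors G r. k_vertex G \<Delta> v)"
proof (intro ballI impI)
  fix s v
  assume s: "s \<in> neighbors G r" and ds: "degree G s < \<Delta>" and crit: "critical_edge G {r, s}"
    and v: "v \<in> neighbors G s - neighbors G r"
  define E where "E = edges G - {{r, s}}"
  define D where "D = {w \<in> neighbors G r. k_vertex G (max_degree G) w}"
  note simple = assms(1)
  have finG: "finite (edges G)" by (rule finite_edges[OF simple])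
  have card2: "\<forall>e\<in>E. card e = 2" and finE: "finite E"
    using simple finG by (auto simp: simple_graph_def E_def)
  have rsG: "{r, s} \<in> edges G" using s by (simp add: neighbors_def)
  have GE: "edges G = insert {r, s} E" using rsG by (auto simp: E_def)
  have rs: "{r, s} \<notin> E" by (simp add: E_def)
  have "card {r, s} = 2" using rsG simple by (simp add: simple_graph_def)
  then have r_ne_s: "r \<noteq> s" by auto
  have in_verts: "x \<in> verts G \<and> y \<in> verts G" if "{x, y} \<in> edges G" for x y
    using that simple by (auto simp: simple_graph_def)
  have finN: "finite (neighbors G x)" for x
  proof (rule finite_subset)
    show "neighbors G x \<subseteq> verts G" using in_verts by (auto simp: neighbors_def)
    show "finite (verts G)" using simple by (simp add: simple_graph_def)
  qed
  have deg_le: "degree G x \<le> \<Delta>" if "x \<in> verts G" for x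
    using that simple assms(3) by (auto simp: max_degree_def simple_graph_def)
  have dr: "degree G r = \<Delta>" using assms(5) by (simp add: k_vertex_def)
  note colourings = critical_edge_colouring[OF simple assms(2) crit, unfolded assms(3)]
  obtain c where c: "edge_colouring E \<Delta> c" using colourings(1) by (auto simp: E_def)
  have uncol: "\<nexists>c. edge_colouring (insert {r, s} E) \<Delta> c" using colourings(2) GE by simp
  interpret S: uncoloured_edge E \<Delta> r s
    using finE card2 rs r_ne_s uncol by unfold_locales auto
  have miss_r: "\<exists>\<mu>. \<mu> \<in> missing E \<Delta> c r" for c
  proof -
    have "{w. {r, w} \<in> E} \<subseteq> neighbors G r - {s}" using rs by (auto simp: neighbors_def E_def)
    then have "card {w. {r, w} \<in> E} \<le> card (neighbors G r - {s})" using finN by (intro card_mono) auto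
    also have "\<dots> < degree G r" unfolding degree_def using s finN by (intro card_Diff1_less)
    finally have "0 < card (missing E \<Delta> c r)"
      using card_missing[OF finE card2, of \<Delta> r c] dr by linarith
    then show ?thesis by (auto simp: card_gt_0_iff)
  qed
  \<comment> \<open>\<open>s\<close> has degree at most \<Delta> - 1 and its edge to
    \<open>r\<close> is uncoloured, so two colours are missing; each starts a fan of its
    own.\<close>
  have miss_s: "\<exists>a b. a \<in> missing E \<Delta> c s \<and> b \<in> missing E \<Delta> c s \<and> a \<noteq> b" for c
  proof -
    have sr: "{s, r} = {r, s}" by (rule insert_commute)
    have "{w. {s, w} \<in> E} \<subseteq> neighbors G s - {r}" using sr by (auto simp: neighbors_def E_def)
    then have "card {w. {s, w} \<in> E} \<le> card (neighbors G s - {r})" using finN by (intro card_mono) auto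
    also have "r \<in> neighbors G s" using rsG sr by (simp add: neighbors_def)
    then have "card (neighbors G s - {r}) < degree G s"
      unfolding degree_def using finN by (intro card_Diff1_less)
    finally have "\<not> card (missing E \<Delta> c s) \<le> Suc 0"
      using card_missing[OF finE card2, of \<Delta> s c] ds by linarith
    moreover have "finite (missing E \<Delta> c s)" by (simp add: missing_def)
    ultimately show ?thesis using card_le_Suc0_iff_eq by blast
  qed
  \<comment> \<open>All \<Delta> colours appear at such a vertex, so its degree reaches the
    maximum.\<close>
  have full: "y \<in> D" if "y \<in> fan E \<Delta> c r A" "missing E \<Delta> c y = {}" for c y A
  proof -
    have y: "{r, y} \<in> edges G" using fan_edge[OF that(1)] by (simp add: E_def)
    have "\<Delta> \<le> card {w. {y, w} \<in> E}" using card_missing[OF finE card2, of \<Delta> y c] that(2) by simp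
    also have "\<dots> \<le> degree G y"
      unfolding degree_def using finN by (intro card_mono) (auto simp: neighbors_def E_def)
    finally have "degree G y = \<Delta>" using deg_le[of y] in_verts[OF y] by simp
    then show ?thesis using y in_verts[OF y] assms(3) by (simp add: D_def k_vertex_def neighbors_def)
  qed
  \<comment> \<open>Three disjoint sets would each contribute an element of \<open>D\<close>, which
    has at most two elements as \<open>r\<close> is light.\<close>
  have no_three: False
    if "X \<inter> Y = {}" "X \<inter> Z = {}" "Y \<inter> Z = {}" "x \<in> X \<inter> D" "y \<in> Y \<inter> D" "z \<in> Z \<inter> D"
    for X Y Z :: "'a set" and x y z
  proof -
    have "x \<noteq> y" "x \<noteq> z" "y \<noteq> z" using that by blast+
    then have "card {x, y, z} = 3" by simp
    moreover have "card {x, y, z} \<le> card D"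
      using that finN by (intro card_mono) (auto simp: D_def)
    ultimately show False using assms(6) by (simp add: light_def D_def)
  qed
  show "k_vertex G \<Delta> v"
  proof (rule ccontr)
    assume nv: "\<not> k_vertex G \<Delta> v"
    have vr: "v \<noteq> r" using nv assms(5) by metis
    have svG: "{s, v} \<in> edges G" and rvG: "{r, v} \<notin> edges G" using v by (auto simp: neighbors_def)
    have sv: "{s, v} \<in> E" using svG vr r_ne_s by (auto simp: E_def doubleton_eq_iff)
    have rv: "{r, v} \<notin> E" using rvG by (simp add: E_def)
    interpret P: uncoloured_edge_path E \<Delta> r s v
      using sv vr rv by unfold_locales
    have "degree G v < \<Delta>"
      using nv deg_le[of v] in_verts[OF svG] by (simp add: k_vertex_def)
    moreover have "card {w. {v, w} \<in> E} \<le> degree G v"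
      unfolding degree_def using finN by (intro card_mono) (auto simp: neighbors_def E_def)
    ultimately have "0 < card (missing E \<Delta> c v)"
      using card_missing[OF finE card2, of \<Delta> v c] by linarith
    then obtain \<alpha> where \<alpha>: "\<alpha> \<in> missing E \<Delta> c v" by (auto simp: card_gt_0_iff)
    show False
    proof (cases "\<exists>c. edge_colouring (insert {r, v} E) \<Delta> c")
      \<comment> \<open>Once \<open>{r, v}\<close> is dropped, its colour is missing at both
        \<open>r\<close> and \<open>v\<close>. This colouring replaces \<open>c\<close>, and the
        colour of \<open>{s, v}\<close> starts the third fan.\<close>
      case True
      then obtain c' where c': "edge_colouring (insert {r, v} E) \<Delta> c'" by blast
      have col: "edge_colouring E \<Delta> c'" by (rule edge_colouring_mono[OF c']) auto
      define \<mu> where "\<mu> = c' {r, v}"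
      have ne: "c' e \<noteq> \<mu>" if "e \<in> E" "r \<in> e \<or> v \<in> e" for e
      proof -
        have "e \<noteq> {r, v}" using that(1) rv by metis
        moreover have "e \<inter> {r, v} \<noteq> {}" using that(2) by blast
        ultimately show ?thesis
          using c' that(1) unfolding edge_colouring_def \<mu>_def by (metis insertCI)
      qed
      have "\<mu> < \<Delta>" using c' by (simp add: edge_colouring_def \<mu>_def)
      with ne have \<mu>: "\<mu> \<in> missing E \<Delta> c' r" "\<mu> \<in> missing E \<Delta> c' v"
        by (auto simp: missing_def)
      obtain a b where ab: "a \<in> missing E \<Delta> c' s" "b \<in> missing E \<Delta> c' s" "a \<noteq> b"
        using miss_s by blast
      obtain x where x: "x \<in> fan E \<Delta> c' r {a}" "missing E \<Delta> c' x = {}"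
        using S.fan_full_vertex[OF col \<mu>(1) ab(1)] by blast
      obtain y where y: "y \<in> fan E \<Delta> c' r {b}" "missing E \<Delta> c' y = {}"
        using S.fan_full_vertex[OF col \<mu>(1) ab(2)] by blast
      obtain z where z: "z \<in> fan E \<Delta> c' r {c' {s, v}}" "missing E \<Delta> c' z = {}"
        using P.fan_of_path_colour(2)[OF col \<mu> ab] by blast
      \<comment> \<open>Disjointness from the fan of \<open>a\<close> comes from exchanging the
        roles of \<open>a\<close> and \<open>b\<close>.\<close>
      note ba = ab(2,1) ab(3)[symmetric]
      from no_three[OF P.fan_of_path_colour(1)[OF col \<mu> ba] P.fan_of_path_colour(1)[OF col \<mu> ab]
          S.fans_disjoint[OF col \<mu>(1) ab], of z x y]
      show False using x(1) y(1) z(1) full[OF x] full[OF y] full[OF z] by simp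
    next
      \<comment> \<open>Now \<open>{r, v}\<close> can play the part of \<open>{r, s}\<close> for the
        same colouring \<open>c\<close>, and a colour missing at \<open>v\<close> starts the third
        fan.\<close>
      case False
      interpret V: uncoloured_edge E \<Delta> r v
        using finE card2 rv vr False by unfold_locales auto
      obtain \<mu> where \<mu>: "\<mu> \<in> missing E \<Delta> c r" using miss_r by blast
      obtain a b where ab: "a \<in> missing E \<Delta> c s" "b \<in> missing E \<Delta> c s" "a \<noteq> b"
        using miss_s by blast
      \<comment> \<open>The end of the chain through \<open>r\<close> is unique, whichever
        uncoloured edge begins the fan, so the elementary property extends across the two
        fans.\<close>
      have el: "missing E \<Delta> c x \<inter> missing E \<Delta> c y = {}"
        if "x \<in> S.fans c" "y \<in> V.fans c" "x \<noteq> y" for x y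
      proof (rule ccontr)
        assume "missing E \<Delta> c x \<inter> missing E \<Delta> c y \<noteq> {}"
        then obtain \<eta> where "\<eta> \<in> missing E \<Delta> c x" "\<eta> \<in> missing E \<Delta> c y" by blast
        moreover have "x \<noteq> r" "y \<noteq> r" using that S.r_notin_fans[of c] V.r_notin_fans[of c] by auto
        ultimately have "x = y"
          using kempe_end_unique[OF c \<mu>, of x \<eta> y] S.fans_linked[OF c \<mu>, of x \<eta>]
            V.fans_linked[OF c \<mu>, of y \<eta>] that by simp
        with that(3) show False ..
      qed
      have dis: "fan E \<Delta> c r {\<theta>} \<inter> fan E \<Delta> c r {\<alpha>} = {}" if \<theta>: "\<theta> \<in> missing E \<Delta> c s" for \<theta>
      proof (rule fan_disjoint)
        show "\<theta> \<noteq> \<alpha>" using el[OF S.s_in_fans V.s_in_fans P.v_ne_s[symmetric]] \<theta> \<alpha> by blast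
        show "\<theta> \<notin> missing E \<Delta> c y" if "y \<in> fan E \<Delta> c r {\<alpha>}" for y
        proof -
          have "y \<in> V.fans c" "s \<noteq> y" using that V.fan_subset_fans[OF \<alpha>] S.s_notin_fan by blast+
          then show ?thesis using el[OF S.s_in_fans] \<theta> by blast
        qed
        show "\<alpha> \<notin> missing E \<Delta> c x" if "x \<in> fan E \<Delta> c r {\<theta>}" for x
        proof -
          have "x \<in> S.fans c" "x \<noteq> v" using that S.fan_subset_fans[OF \<theta>] V.s_notin_fan by blast+
          then show ?thesis using el[OF _ V.s_in_fans] \<alpha> by blast
        qed
        show "missing E \<Delta> c x \<inter> missing E \<Delta> c y = {}"
          if "x \<in> fan E \<Delta> c r {\<theta>}" "y \<in> fan E \<Delta> c r {\<alpha>}" "x \<noteq> y" for x y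
          using el that S.fan_subset_fans[OF \<theta>] V.fan_subset_fans[OF \<alpha>] by blast
      qed
      obtain x where x: "x \<in> fan E \<Delta> c r {a}" "missing E \<Delta> c x = {}"
        using S.fan_full_vertex[OF c \<mu> ab(1)] by blast
      obtain y where y: "y \<in> fan E \<Delta> c r {b}" "missing E \<Delta> c y = {}"
        using S.fan_full_vertex[OF c \<mu> ab(2)] by blast
      obtain z where z: "z \<in> fan E \<Delta> c r {\<alpha>}" "missing E \<Delta> c z = {}"
        using V.fan_full_vertex[OF c \<mu> \<alpha>] by blast
      from no_three[OF S.fans_disjoint[OF c \<mu> ab] dis[OF ab(1)] dis[OF ab(2)], of x y z]
      show False using x(1) y(1) z(1) full[OF x] full[OF y] full[OF z] by simp
    qed
  qed
qed

end
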